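(* Let $\mathscr{U}$ be a selective ultrafilter on $\omega$. Then $\mathscr{U}$ is a Michael ultrafilter if and only if $\mathrm{cof}(\omega^\omega/\mathscr{U}) \leq \mathrm{cin}(\omega^\omega/\mathscr{U})$.
   Context: All ultrafilters are non-principal ultrafilters on $\omega$; $\omega^\omega$ is the Baire space (product topology, $\omega$ discrete). For an ultrafilter $\mathscr{U}$ and $f,g\in\omega^\omega$, $f\leq_{\mathscr{U}} g$ means $\{n\in\omega : f(n)\leq g(n)\}\in\mathscr{U}$. For $K\subseteq\omega^\omega$, $\mathrm{cof}(K/\mathscr{U})$ is the least cardinality of a set $D\subseteq K$ such that for every $f\in K$ there is $g\in D$ with $f\leq_{\mathscr{U}} g$. The cardinal $\mathrm{cin}(\omega^\omega/\mathscr{U})$ is the least cardinality of a family $D$ of finite-to-one non-decreasing functions in $\omega^\omega$ such that for every finite-to-one non-decreasing $f\in\omega^\omega$ there is $g\in D$ with $g\leq_{\mathscr{U}} f$. $\mathscr{U}$ is a Michael ultrafilter if for every compact $K\subseteq\omega^\omega$, if $\mathrm{cof}(K/\mathscr{U})>\omega$ then $\mathrm{cof}(K/\mathscr{U})\geq\mathrm{cof}(\omega^\omega/\mathscr{U})$. $\mathscr{U}$ is a p-point if every decreasing sequence $\{U_i : i\in\omega\}\subseteq\mathscr{U}$ has a pseudointersection in $\mathscr{U}$, i.e. a set $U\in\mathscr{U}$ with $U\setminus U_n$ finite for all $n$. $\mathscr{U}$ is a q-point if for every partition $\langle I_n : n\in\omega\rangle$ of $\omega$ into (finite) intervals there is $U\in\mathscr{U}$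 with $|U\cap I_n|\leq 1$ for all $n$. $\mathscr{U}$ is selective if it is both a p-point and a q-point. *)

theory Defs
  imports "HOL-Analysis.Function_Topology"
begin

unbundle cardinal_syntax

text \<open>
  Ultrafilters on \<open>\<omega>\<close> are values of the library type \<open>nat filter\<close>;
  a set \<open>A\<close> belongs to the filter \<open>F\<close> iff \<open>\<forall>\<^sub>F n in F. n \<in> A\<close>.
  The library type includes the improper filter \<open>bot\<close>, which has to be excluded.
\<close>

definition nonprincipal_ultrafilter :: "nat filter \<Rightarrow> bool" where
  "nonprincipal_ultrafilter F \<longleftrightarrow>
     F \<noteq> bot \<and>
     (\<forall>A. (\<forall>\<^sub>F n in F. n \<in> A) \<or> (\<forall>\<^sub>F n in F. n \<in> - A)) \<and>
     (\<forall>n. F \<noteq> principal {n})"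

definition le_mod :: "nat filter \<Rightarrow> (nat \<Rightarrow> nat) \<Rightarrow> (nat \<Rightarrow> nat) \<Rightarrow> bool" where
  "le_mod F f g \<longleftrightarrow> (\<forall>\<^sub>F n in F. f n \<le> g n)"

text \<open>
  Cardinals are represented, as in the library, by cardinal orders and compared with
  \<open>\<le>o\<close> and \<open><o\<close>; the cardinal \<open>\<omega>\<close> is \<open>natLeq\<close>.
  The least cardinality of a member of \<open>\<D>\<close> is meaningful when \<open>\<D> \<noteq> {}\<close>:
  it is then attained and is a lower bound (\<open>least_card_attained\<close>, \<open>least_card_le\<close>).
\<close>

definition least_card :: "'a set set \<Rightarrow> 'a rel" where
  "least_card \<D> = |SOME D. D \<in> \<D> \<and> (\<forall>E\<in>\<D>. |D| \<le>o |E| )|"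

lemma least_card_minimizer:
  assumes "\<D> \<noteq> {}"
  shows "\<exists>D\<in>\<D>. least_card \<D> = |D| \<and> (\<forall>E\<in>\<D>. |D| \<le>o |E| )"
proof -
  have "\<exists>r\<in>card_of ` \<D>. \<forall>r'\<in>card_of ` \<D>. r \<le>o r'"
    using assms by (intro exists_minim_Card_order) (auto simp: card_of_Card_order)
  then have "\<exists>D. D \<in> \<D> \<and> (\<forall>E\<in>\<D>. |D| \<le>o |E| )"
    by auto
  from someI_ex[OF this] show ?thesis
    unfolding least_card_def by blast
qed

lemma least_card_attained: "\<D> \<noteq> {} \<Longrightarrow> \<exists>D\<in>\<D>. least_card \<D> = |D|"
  using least_card_minimizer by blast

lemma least_card_le: "D \<in> \<D> \<Longrightarrow> least_card \<D> \<le>o |D|"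
  using least_card_minimizer[of \<D>] by (metis empty_iff)

definition cof_mod :: "(nat \<Rightarrow> nat) set \<Rightarrow> nat filter \<Rightarrow> (nat \<Rightarrow> nat) rel" where
  "cof_mod K F = least_card {D. D \<subseteq> K \<and> (\<forall>f\<in>K. \<exists>g\<in>D. le_mod F f g)}"

definition finite_to_one_mono :: "(nat \<Rightarrow> nat) set" where
  "finite_to_one_mono = {f. (\<forall>k. finite (f -` {k})) \<and> mono f}"

definition cin_mod :: "nat filter \<Rightarrow> (nat \<Rightarrow> nat) rel" where
  "cin_mod F = least_card
     {D. D \<subseteq> finite_to_one_mono \<and> (\<forall>f\<in>finite_to_one_mono. \<exists>g\<in>D. le_mod F g f)}"

text \<open>
  Both families are nonempty, as witnessed by the whole set, so the cardinals are meaningful.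
\<close>

lemma cof_mod_family_nonempty:
  "{D. D \<subseteq> K \<and> (\<forall>f\<in>K. \<exists>g\<in>D. le_mod F f g)} \<noteq> {}"
proof -
  have "K \<in> {D. D \<subseteq> K \<and> (\<forall>f\<in>K. \<exists>g\<in>D. le_mod F f g)}"
    by (auto simp: le_mod_def intro!: bexI)
  then show ?thesis by blast
qed

lemma cin_mod_family_nonempty:
  "{D. D \<subseteq> finite_to_one_mono \<and> (\<forall>f\<in>finite_to_one_mono. \<exists>g\<in>D. le_mod F g f)} \<noteq> {}"
proof -
  have "finite_to_one_mono
      \<in> {D. D \<subseteq> finite_to_one_mono \<and> (\<forall>f\<in>finite_to_one_mono. \<exists>g\<in>D. le_mod F g f)}"
    by (auto simp: le_mod_def intro!: bexI)
  then show ?thesis by blast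
qed

text \<open>
  Compactness refers to the library topology on \<open>nat \<Rightarrow> nat\<close>: the product topology of
  the discrete topology on \<open>nat\<close>, that is, the Baire space.
\<close>

definition michael_ultrafilter :: "nat filter \<Rightarrow> bool" where
  "michael_ultrafilter F \<longleftrightarrow>
     nonprincipal_ultrafilter F \<and>
     (\<forall>K. compact K \<longrightarrow> natLeq <o cof_mod K F \<longrightarrow> cof_mod UNIV F \<le>o cof_mod K F)"

definition p_point :: "nat filter \<Rightarrow> bool" where
  "p_point F \<longleftrightarrow>
     nonprincipal_ultrafilter F \<and>
     (\<forall>U :: nat \<Rightarrow> nat set. decseq U \<and> (\<forall>i. \<forall>\<^sub>F n in F. n \<in> U i) \<longrightarrow>
        (\<exists>V. (\<forall>\<^sub>F n in F. n \<in> V) \<and> (\<forall>i. finite (V - U i))))"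

definition q_point :: "nat filter \<Rightarrow> bool" where
  "q_point F \<longleftrightarrow>
     nonprincipal_ultrafilter F \<and>
     (\<forall>I :: nat \<Rightarrow> nat set.
        (\<forall>k. \<exists>a b. a < b \<and> I k = {a..<b}) \<and> disjoint_family I \<and> (\<Union>k. I k) = UNIV \<longrightarrow>
        (\<exists>V. (\<forall>\<^sub>F n in F. n \<in> V) \<and> (\<forall>k. card (V \<inter> I k) \<le> 1)))"

definition selective :: "nat filter \<Rightarrow> bool" where
  "selective F \<longleftrightarrow> p_point F \<and> q_point F"

end

theory Submission
  imports Defs "HOL-Analysis.Analysis" "HOL-Library.Countable_Set_Type"
begin

text \<open>
  For a selective ultrafilter, the coinitiality of the finite-to-one non-decreasing functions is
  the least uncountable cofinality of a compact set: \<open>cin_le_cof_compact\<close> shows that it is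
  a lower bound, and the compact set \<open>range set_code\<close> shows that it is attained
  (\<open>uncountable_cof_range_set_code\<close>, \<open>cof_range_set_code_le_cin\<close>).  Being a Michael
  ultrafilter says that the cofinality of the whole ultrapower is at most every such cofinality,
  so the equivalence follows.

  Selectivity enters through two consequences.  A p-point allows countably many sets \<open>P k\<close>
  of the ultrafilter to be diagonalised by a finite-to-one non-decreasing \<open>f\<close>: on a large set
  of \<open>n\<close>, all of \<open>P 0\<close>, \<dots>, \<open>P (f n)\<close> hold at \<open>n\<close> (\<open>p_point_diagonal\<close>).
  A q-point contains, for every finite-to-one non-decreasing \<open>f\<close>, a set so sparse that
  \<open>a < f b\<close> for any two of its elements \<open>a < b\<close> (\<open>q_point_sparse_set\<close>).

  For the lower bound, let \<open>K\<close> be compact of uncountable cofinality and \<open>D\<close> cofinal in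
  \<open>K\<close>.  Discarding the countably many cylinders that have a strict upper bound in \<open>K\<close> leaves a
  nonempty core \<open>K'\<close> that is cofinal inside each of its own cylinders.  For \<open>w \<in> D\<close> and
  each \<open>k\<close>, compactness leaves only finitely many restrictions to \<open>k\<close>, so for almost all
  \<open>n\<close> every restriction to \<open>k\<close> of an element of \<open>K'\<close> extends to an element of
  \<open>K'\<close> that exceeds \<open>w\<close> at \<open>n\<close>.  Diagonalising over \<open>k\<close> gives a finite-to-one
  non-decreasing \<open>\<phi> w\<close>.  These functions are coinitial: if \<open>f\<close> were strictly below all of
  them, take a set \<open>A\<close> in the ultrafilter that is sparse for \<open>f\<close> and follow the branch of
  \<open>K\<close> that at each element of \<open>A\<close> is as large as the previous choices allow.  The choice at
  \<open>b \<in> A\<close> depends on what was fixed up to the preceding element \<open>a < f b < \<phi> w b\<close>, so it beats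
  \<open>w\<close> there, for almost all \<open>b\<close>.  The branch does not depend on \<open>w\<close>; hence it exceeds all of \<open>D\<close>, which is
  absurd.

  For the attained bound, the code of \<open>A\<close> has the value \<open>n - card (A \<inter> {..<n})\<close> at
  \<open>n \<in> A\<close> and 0 elsewhere.  Codes of sets outside the ultrafilter vanish modulo it, and for sets
  inside it a larger code means a slower counting function.  By the q-point property these
  counting functions are coinitial among all finite-to-one non-decreasing functions, of which no
  countable family is coinitial by the p-point property.
\<close>

section \<open>Strict domination modulo an ultrafilter\<close>

definition lt_mod :: "nat filter \<Rightarrow> (nat \<Rightarrow> nat) \<Rightarrow> (nat \<Rightarrow> nat) \<Rightarrow> bool" where
  "lt_mod F f g \<longleftrightarrow> (\<forall>\<^sub>F n in F. f n < g n)"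

lemma lt_mod_le_trans: "lt_mod F f g \<Longrightarrow> le_mod F g h \<Longrightarrow> lt_mod F f h"
  unfolding lt_mod_def le_mod_def by (erule (1) eventually_elim2) simp

lemma lt_mod_trans: "lt_mod F f g \<Longrightarrow> lt_mod F g h \<Longrightarrow> lt_mod F f h"
  unfolding lt_mod_def by (erule (1) eventually_elim2) simp

lemma ultrafilter_dichotomy:
  assumes "nonprincipal_ultrafilter F"
  shows "(\<forall>\<^sub>F n in F. P n) \<or> (\<forall>\<^sub>F n in F. \<not> P n)"
proof -
  have "(\<forall>\<^sub>F n in F. n \<in> {n. P n}) \<or> (\<forall>\<^sub>F n in F. n \<in> - {n. P n})"
    using assms unfolding nonprincipal_ultrafilter_def by blast
  then show ?thesis by simp
qed

lemma ultrafilter_eventually_not: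
  assumes "nonprincipal_ultrafilter F"
  shows "(\<forall>\<^sub>F n in F. \<not> P n) \<longleftrightarrow> \<not> (\<forall>\<^sub>F n in F. P n)"
proof
  assume "\<forall>\<^sub>F n in F. \<not> P n"
  show "\<not> (\<forall>\<^sub>F n in F. P n)"
  proof
    assume "\<forall>\<^sub>F n in F. P n"
    with \<open>\<forall>\<^sub>F n in F. \<not> P n\<close> have "\<forall>\<^sub>F n in F. False"
      by (rule eventually_elim2) simp
    with assms show False
      by (simp add: nonprincipal_ultrafilter_def eventually_False)
  qed
qed (use ultrafilter_dichotomy[OF assms] in blast)

lemma not_le_mod_iff:
  assumes "nonprincipal_ultrafilter F"
  shows "\<not> le_mod F f g \<longleftrightarrow> lt_mod F g f"
  using ultrafilter_eventually_not[OF assms, of "\<lambda>n. f n \<le> g n"]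
  by (simp add: le_mod_def lt_mod_def not_le)

lemma not_lt_mod_self:
  assumes "nonprincipal_ultrafilter F"
  shows "\<not> lt_mod F f f"
  using not_le_mod_iff[OF assms, of f f] by (simp add: le_mod_def)

lemma eventually_ge_nonprincipal:
  assumes F: "nonprincipal_ultrafilter F"
  shows "\<forall>\<^sub>F n in F. k \<le> n"
proof -
  have ne: "\<forall>\<^sub>F n in F. n \<noteq> m" for m
  proof (rule ccontr)
    assume "\<not> (\<forall>\<^sub>F n in F. n \<noteq> m)"
    then have ev: "\<forall>\<^sub>F n in F. n = m"
      using ultrafilter_dichotomy[OF F, of "\<lambda>n. n = m"] by blast
    have "eventually P F \<longleftrightarrow> P m" for P
    proof
      assume "P m"
      with ev show "eventually P F" by (auto elim: eventually_mono)
    next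
      assume "eventually P F"
      show "P m"
      proof (rule ccontr)
        assume "\<not> P m"
        with ev have "\<forall>\<^sub>F n in F. \<not> P n" by (auto elim: eventually_mono)
        with \<open>eventually P F\<close> show False using ultrafilter_eventually_not[OF F] by blast
      qed
    qed
    then have "F = principal {m}"
      by (simp add: filter_eq_iff eventually_principal)
    with F show False by (simp add: nonprincipal_ultrafilter_def)
  qed
  have "\<forall>\<^sub>F n in F. \<forall>m\<in>{..<k}. n \<noteq> m"
    using ne by (subst eventually_ball_finite_distrib) auto
  then show ?thesis
    by (rule eventually_mono) (auto simp: not_less[symmetric])
qed

lemma finite_to_one_mono_iff:
  "f \<in> finite_to_one_mono \<longleftrightarrow> mono f \<and> (\<forall>k. \<exists>n. k \<le> f n)"
proof
  assume f: "f \<in> finite_to_one_mono"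
  have "\<exists>n. k \<le> f n" for k
  proof (rule ccontr)
    assume "\<nexists>n. k \<le> f n"
    then have "(\<Union>j<k. f -` {j}) = UNIV" by (auto simp: not_le)
    moreover have "finite (\<Union>j<k. f -` {j})"
      using f by (simp add: finite_to_one_mono_def)
    ultimately show False by simp
  qed
  with f show "mono f \<and> (\<forall>k. \<exists>n. k \<le> f n)" by (simp add: finite_to_one_mono_def)
next
  assume f: "mono f \<and> (\<forall>k. \<exists>n. k \<le> f n)"
  have "finite (f -` {k})" for k
  proof -
    obtain n where n: "Suc k \<le> f n" using f by blast
    have "f -` {k} \<subseteq> {..<n}"
    proof
      fix m assume "m \<in> f -` {k}"
      then have "f m < f n" using n by simp
      then show "m \<in> {..<n}" using f by (metis lessThan_iff mono_strict_invE)
    qed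
    then show ?thesis by (rule finite_subset) simp
  qed
  with f show "f \<in> finite_to_one_mono" by (simp add: finite_to_one_mono_def)
qed

lemma eventually_ge_finite_to_one_mono:
  assumes F: "nonprincipal_ultrafilter F" and f: "f \<in> finite_to_one_mono"
  shows "\<forall>\<^sub>F n in F. k \<le> f n"
proof -
  obtain m where m: "k \<le> f m" "mono f" using f by (auto simp: finite_to_one_mono_iff)
  show ?thesis
    by (rule eventually_mono[OF eventually_ge_nonprincipal[OF F, of m]])
      (use m in \<open>meson monoD order_trans\<close>)
qed

section \<open>What the two halves of selectivity give\<close>

text \<open>
  With a pseudointersection \<open>V\<close> of the decreasing sets on which \<open>P 0\<close>, \<dots>, \<open>P i\<close> hold,
  let \<open>f n\<close> be the largest \<open>k \<le> n\<close> such that all of \<open>V\<close> from \<open>n\<close> on lies in the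
  \<open>k\<close>-th set.  Looking at the tail of \<open>V\<close> rather than at \<open>n\<close> alone is what makes
  \<open>f\<close> monotone.
\<close>

lemma p_point_diagonal:
  assumes p: "p_point F" and P: "\<And>k. \<forall>\<^sub>F n in F. P k n"
  obtains f where "f \<in> finite_to_one_mono" "\<forall>\<^sub>F n in F. \<forall>k\<le>f n. P k n"
proof -
  have F: "nonprincipal_ultrafilter F" using p by (simp add: p_point_def)
  define U where "U i = {n. \<forall>k\<le>i. P k n}" for i
  have "decseq U" by (auto simp: decseq_def U_def)
  moreover have "\<forall>\<^sub>F n in F. n \<in> U i" for i
  proof -
    have "\<forall>\<^sub>F n in F. \<forall>k\<in>{..i}. P k n"
      using P by (subst eventually_ball_finite_distrib) auto
    then show ?thesis by (rule eventually_mono) (simp add: U_def)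
  qed
  ultimately obtain V where V: "\<forall>\<^sub>F n in F. n \<in> V" and fin: "\<And>i. finite (V - U i)"
    using p unfolding p_point_def by meson
  define S where "S n = {k. k \<le> n \<and> V \<inter> {n..} \<subseteq> U k}" for n
  \<comment> \<open>The default 0 serves the finitely many \<open>n\<close> for which no \<open>k\<close> qualifies.\<close>
  define f where "f n = Max (insert 0 (S n))" for n
  have finS: "finite (S n)" for n by (simp add: S_def)
  have S_large: "\<exists>N. \<forall>n\<ge>N. k \<in> S n" for k
  proof -
    obtain N where N: "V - U k \<subseteq> {..<N}" using fin[of k] finite_nat_bounded by blast
    then have "\<forall>n\<ge>max N k. k \<in> S n" by (fastforce simp: S_def)
    then show ?thesis by blast
  qed
  have f_in: "k \<in> S n \<Longrightarrow> k \<le> f n" for k n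
    unfolding f_def using finS by (intro Max_ge) auto
  have "S m \<subseteq> S n" if "m \<le> n" for m n
    using that by (fastforce simp: S_def)
  then have "mono f"
    unfolding f_def by (intro monoI Max_mono) (auto simp: finS)
  moreover have "\<exists>n. k \<le> f n" for k
    using S_large[of k] f_in by blast
  ultimately have "f \<in> finite_to_one_mono" by (simp add: finite_to_one_mono_iff)
  moreover have "\<forall>\<^sub>F n in F. \<forall>k\<le>f n. P k n"
  proof -
    obtain N where N: "\<forall>n\<ge>N. 0 \<in> S n" using S_large by blast
    from eventually_ge_nonprincipal[OF F, of N] V show ?thesis
    proof (rule eventually_elim2)
      fix n assume n: "N \<le> n" "n \<in> V"
      then have "insert 0 (S n) = S n" using N by auto
      moreover have "f n \<in> insert 0 (S n)"
        unfolding f_def using finS by (intro Max_in) auto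
      ultimately have "f n \<in> S n" by simp
      then have "n \<in> U (f n)" using n by (auto simp: S_def)
      then show "\<forall>k\<le>f n. P k n" by (simp add: U_def)
    qed
  qed
  ultimately show ?thesis by (rule that)
qed

text \<open>
  Cut \<open>\<omega>\<close> into intervals such that \<open>f\<close>, evaluated at a cut point, has reached the
  preceding cut point.  A selector has at most one element in each interval; keeping only the
  intervals of one parity (the ultrafilter decides which) leaves a full interval between any two
  of its elements, and that gap yields \<open>a < f b\<close>.
\<close>

lemma q_point_sparse_set:
  assumes q: "q_point F" and f: "f \<in> finite_to_one_mono"
  obtains A where "\<forall>\<^sub>F n in F. n \<in> A" "\<And>a b. a \<in> A \<Longrightarrow> b \<in> A \<Longrightarrow> a < b \<Longrightarrow> a < f b"
proof -
  have F: "nonprincipal_ultrafilter F" using q by (simp add: q_point_def)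
  have mono: "mono f" and unb: "\<And>k. \<exists>n. k \<le> f n"
    using f by (auto simp: finite_to_one_mono_iff)
  have "\<exists>d>c. c \<le> f d" for c
  proof -
    obtain n where "c \<le> f n" using unb by blast
    moreover have "f n \<le> f (max n (Suc c))" using mono by (simp add: monoD)
    ultimately show ?thesis by (intro exI[of _ "max n (Suc c)"]) auto
  qed
  then obtain next_cut where cut: "\<And>c. c < next_cut c" "\<And>c. c \<le> f (next_cut c)"
    by metis
  define b where "b j = (next_cut ^^ j) 0" for j
  have b_0: "b 0 = 0" and b_Suc: "b j < b (Suc j)" and b_f: "b j \<le> f (b (Suc j))" for j
    using cut by (simp_all add: b_def)
  have b_less: "strict_mono b" using b_Suc by (simp add: strict_mono_Suc_iff)
  then have b_mono: "i \<le> j \<Longrightarrow> b i \<le> b j" for i j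
    by (simp add: strict_mono_less_eq)
  define I where "I j = {b j..<b (Suc j)}" for j
  have I_order: "i \<le> j" if "m \<in> I i" "n \<in> I j" "m \<le> n" for i j m n
  proof (rule ccontr)
    assume "\<not> i \<le> j"
    then have "b (Suc j) \<le> b i" using b_mono by simp
    with that show False by (simp add: I_def)
  qed
  have I_cover: "\<exists>j. n \<in> I j" for n
  proof -
    have "\<exists>j. n < b (Suc j)"
      using b_less by (metis Suc_le_lessD strict_mono_imp_increasing)
    then obtain j where "n < b (Suc j)" "\<forall>i<j. \<not> n < b (Suc i)"
      using exists_least_iff[of "\<lambda>j. n < b (Suc j)"] by blast
    then have "n \<in> I j" by (cases j) (auto simp: I_def b_0 not_less)
    then show ?thesis by blast
  qed
  have I_unique: "i = j" if "n \<in> I i" "n \<in> I j" for n i j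
    using I_order[OF that] I_order[OF that(2) that(1)] by simp
  then have "disjoint_family I" unfolding disjoint_family_on_def by blast
  moreover have "(\<Union>j. I j) = UNIV" using I_cover by blast
  moreover have "\<forall>k. \<exists>a c. a < c \<and> I k = {a..<c}" using b_Suc I_def by blast
  ultimately obtain V where V: "\<forall>\<^sub>F n in F. n \<in> V" and card: "\<And>k. card (V \<inter> I k) \<le> 1"
    using q unfolding q_point_def by metis
  define E where "E = (\<Union>j\<in>{j. even j}. I j)"
  have separated: "m < f n"
    if mn: "m \<in> V" "n \<in> V" "m < n" and par: "m \<in> I i" "n \<in> I j" "even i \<longleftrightarrow> even j" for m n i j
  proof -
    have "i \<le> j" using mn par I_order by simp
    moreover have "i \<noteq> j"
    proof
      assume "i = j"
      then have "{m, n} \<subseteq> V \<inter> I i" using mn par by simp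
      moreover have "finite (V \<inter> I i)" by (simp add: I_def)
      ultimately have "card {m, n} \<le> 1" using card card_mono order_trans by metis
      with mn show False by simp
    qed
    moreover have "Suc i \<noteq> j" using par by auto
    ultimately have "Suc (Suc i) \<le> j" by simp
    have "m < b (Suc i)" using par by (simp add: I_def)
    also have "\<dots> \<le> f (b (Suc (Suc i)))" by (rule b_f)
    also have "\<dots> \<le> f n"
      using b_mono[OF \<open>Suc (Suc i) \<le> j\<close>] par mono by (auto simp: I_def intro!: monoD[OF mono])
    finally show ?thesis .
  qed
  have E_iff: "even j \<longleftrightarrow> n \<in> E" if "n \<in> I j" for n j
    using that I_unique unfolding E_def by blast
  have sep: "m < f n" if "m \<in> V" "n \<in> V" "m < n" "m \<in> E \<longleftrightarrow> n \<in> E" for m n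
    using that separated I_cover E_iff by metis
  show ?thesis
  proof (cases "\<forall>\<^sub>F n in F. n \<in> E")
    case True
    with V have "\<forall>\<^sub>F n in F. n \<in> V \<inter> E" by (simp add: eventually_conj_iff)
    then show ?thesis by (rule that) (use sep in blast)
  next
    case False
    then have "\<forall>\<^sub>F n in F. n \<notin> E" using ultrafilter_dichotomy[OF F] by blast
    with V have "\<forall>\<^sub>F n in F. n \<in> V - E" by (simp add: eventually_conj_iff)
    then show ?thesis by (rule that) (use sep in blast)
  qed
qed

text \<open>
  Diagonalise against the statements that the first \<open>k\<close> members of the family exceed \<open>k\<close>.
  This lower bound is why the cofinality of \<open>range set_code\<close> is uncountable.
\<close>

lemma countable_finite_to_one_mono_lower_bound:
  assumes p: "p_point F" and C: "countable C" "C \<subseteq> finite_to_one_mono"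
  obtains f where "f \<in> finite_to_one_mono" "\<And>g. g \<in> C \<Longrightarrow> lt_mod F f g"
proof (cases "C = {}")
  case True
  have "(\<lambda>n. n) \<in> finite_to_one_mono" by (auto simp: finite_to_one_mono_iff mono_def)
  then show ?thesis using True by (intro that) auto
next
  case False
  have F: "nonprincipal_ultrafilter F" using p by (simp add: p_point_def)
  obtain e :: "nat \<Rightarrow> nat \<Rightarrow> nat" where e: "range e = C"
    using False C(1) uncountable_def by blast
  have "\<forall>\<^sub>F n in F. \<forall>i\<in>{..k}. k < e i n" for k
  proof -
    have "\<forall>\<^sub>F n in F. Suc k \<le> e i n" for i
      using e C(2) by (intro eventually_ge_finite_to_one_mono[OF F]) blast
    then show ?thesis by (subst eventually_ball_finite_distrib) (auto simp: Suc_le_eq)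
  qed
  from p_point_diagonal[OF p this] obtain f where f: "f \<in> finite_to_one_mono"
    and ev: "\<forall>\<^sub>F n in F. \<forall>k\<le>f n. \<forall>i\<in>{..k}. k < e i n" .
  show ?thesis
  proof (rule that[OF f])
    fix g assume "g \<in> C"
    then obtain i where i: "g = e i" using e by blast
    from ev eventually_ge_finite_to_one_mono[OF F f, of i] show "lt_mod F f g"
      unfolding lt_mod_def i by (rule eventually_elim2) auto
  qed
qed

section \<open>Cofinality and coinitiality as attained minima\<close>

lemma natLeq_less_cof_modD:
  assumes F: "nonprincipal_ultrafilter F" and K: "natLeq <o cof_mod K F"
    and E: "countable E" "E \<subseteq> K"
  obtains x where "x \<in> K" "\<And>y. y \<in> E \<Longrightarrow> lt_mod F y x"
proof (rule ccontr)
  assume "\<not> thesis"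
  with that have "\<forall>f\<in>K. \<exists>g\<in>E. le_mod F f g" using not_le_mod_iff[OF F] by metis
  then have "cof_mod K F \<le>o |E|"
    unfolding cof_mod_def using E by (intro least_card_le) simp
  also have "|E| \<le>o natLeq" using E by (simp add: countable_card_le_natLeq)
  finally show False using K not_ordLess_ordLeq by blast
qed

lemma cof_modE:
  obtains D where "D \<subseteq> K" "\<And>f. f \<in> K \<Longrightarrow> \<exists>g\<in>D. le_mod F f g" "cof_mod K F = |D|"
  using least_card_attained[OF cof_mod_family_nonempty[of K F]] unfolding cof_mod_def by blast

lemma cof_mod_le:
  "D \<subseteq> K \<Longrightarrow> (\<And>f. f \<in> K \<Longrightarrow> \<exists>g\<in>D. le_mod F f g) \<Longrightarrow> cof_mod K F \<le>o |D|"
  unfolding cof_mod_def by (rule least_card_le) simp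

lemma natLeq_less_cof_modI:
  assumes "\<And>E. countable E \<Longrightarrow> E \<subseteq> K \<Longrightarrow> \<exists>x\<in>K. \<forall>y\<in>E. \<not> le_mod F x y"
  shows "natLeq <o cof_mod K F"
proof -
  obtain D where D: "D \<subseteq> K" "\<And>f. f \<in> K \<Longrightarrow> \<exists>g\<in>D. le_mod F f g" "cof_mod K F = |D|"
    by (rule cof_modE) blast
  then have "\<not> countable D" using assms by meson
  then have "\<not> |D| \<le>o natLeq" by (simp add: countable_card_le_natLeq)
  then show ?thesis
    unfolding D(3) using natLeq_Well_order card_of_Well_order not_ordLeq_iff_ordLess by blast
qed

lemma cin_modE:
  obtains D where "D \<subseteq> finite_to_one_mono"
    "\<And>f. f \<in> finite_to_one_mono \<Longrightarrow> \<exists>g\<in>D. le_mod F g f" "cin_mod F = |D|"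
  using least_card_attained[OF cin_mod_family_nonempty[of F]] unfolding cin_mod_def by blast

lemma cin_mod_le:
  "D \<subseteq> finite_to_one_mono \<Longrightarrow> (\<And>f. f \<in> finite_to_one_mono \<Longrightarrow> \<exists>g\<in>D. le_mod F g f) \<Longrightarrow>
    cin_mod F \<le>o |D|"
  unfolding cin_mod_def by (rule least_card_le) simp

section \<open>A compact set of cofinality at most the coinitiality\<close>

text \<open>
  Only the values at elements of \<open>A\<close> carry information modulo an ultrafilter containing
  \<open>A\<close>.  The value 0 off \<open>A\<close> keeps limits harmless: a limit of codes is again a code, and it
  vanishes modulo the ultrafilter if it codes a set outside it.  The simpler functions
  \<open>\<lambda>n. n - g n\<close>, with \<open>g\<close> finite-to-one and non-decreasing, would accumulate at the
  identity, which is above all of them.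
\<close>

definition set_code :: "nat set \<Rightarrow> nat \<Rightarrow> nat" where
  "set_code A n = (if n \<in> A then n - card (A \<inter> {..<n}) else 0)"

text \<open>
  Coding is continuous in the characteristic function of the set, so the range is a continuous
  image of the Cantor space.
\<close>

lemma compact_range_set_code: "compact (range set_code)"
proof -
  define C :: "(nat \<Rightarrow> nat) set" where "C = PiE UNIV (\<lambda>_. {0, 1})"
  define h :: "(nat \<Rightarrow> nat) \<Rightarrow> nat \<Rightarrow> nat"
    where "h x n = x n * (n - (\<Sum>m<n. x m))" for x n
  have "compactin (product_topology (\<lambda>_. euclidean) UNIV) C"
    unfolding C_def by (simp add: compactin_PiE)
  then have "compact C" by (simp add: euclidean_product_topology)
  moreover have "continuous_on C h"
  proof (rule continuous_on_coordinatewise_then_product)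
    fix n
    have coord: "continuous_on C (\<lambda>x. x i)" for i
      by (rule continuous_on_subset[OF continuous_on_product_coordinates subset_UNIV])
    have "continuous_on C (\<lambda>x. \<Sum>m<n. x m)" by (intro continuous_on_sum coord)
    then have "continuous_on C (\<lambda>x. n - (\<Sum>m<n. x m))"
      by (rule continuous_on_compose2[OF Topological_Spaces.continuous_on_discrete[of UNIV "\<lambda>s. n - s"]]) simp
    with coord[of n] show "continuous_on C (\<lambda>x. h x n)"
      unfolding h_def by (rule continuous_on_mult')
  qed
  ultimately have "compact (h ` C)" by (intro compact_continuous_image)
  moreover have "h ` C = range set_code"
  proof -
    have "C = range (\<lambda>A n. if n \<in> A then 1 else 0)"
    proof (intro equalityI subsetI)
      fix x assume "x \<in> C"
      then have "x n = 0 \<or> x n = 1" for n by (auto simp: C_def PiE_def Pi_def)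
      then have "x = (\<lambda>n. if n \<in> {n. x n = 1} then 1 else 0)" by (auto simp: fun_eq_iff)
      then show "x \<in> range (\<lambda>A n. if n \<in> A then 1 else 0)" by blast
    qed (auto simp: C_def split: if_splits)
    moreover have "h (\<lambda>n. if n \<in> A then 1 else 0) = set_code A" for A
    proof
      fix n
      have "(\<Sum>m<n. if m \<in> A then 1 else 0) = card (A \<inter> {..<n})"
        by (simp add: sum.If_cases Int_commute)
      then show "h (\<lambda>n. if n \<in> A then 1 else 0) n = set_code A n"
        by (simp add: h_def set_code_def)
    qed
    ultimately show ?thesis by (simp add: image_image)
  qed
  ultimately show ?thesis by simp
qed

lemma infinite_if_eventually_mem:
  assumes F: "nonprincipal_ultrafilter F" and A: "\<forall>\<^sub>F n in F. n \<in> A"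
  shows "infinite A"
proof
  assume "finite A"
  then obtain k where "A \<subseteq> {..<k}" using finite_nat_bounded by blast
  then have "\<forall>\<^sub>F n in F. \<not> k \<le> n" using A by (auto elim!: eventually_mono)
  with eventually_ge_nonprincipal[OF F, of k] show False
    using ultrafilter_eventually_not[OF F] by blast
qed

lemma count_below_finite_to_one_mono:
  assumes F: "nonprincipal_ultrafilter F" and A: "\<forall>\<^sub>F n in F. n \<in> A"
  shows "(\<lambda>n. card (A \<inter> {..<n})) \<in> finite_to_one_mono"
proof -
  have "infinite A" using F A by (rule infinite_if_eventually_mem)
  have "\<exists>n. k \<le> card (A \<inter> {..<n})" for k
  proof -
    obtain B where B: "B \<subseteq> A" "finite B" "card B = k"
      using \<open>infinite A\<close> infinite_arbitrarily_large by blast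
    obtain n where "B \<subseteq> {..<n}" using B finite_nat_bounded by blast
    then have "card B \<le> card (A \<inter> {..<n})" using B by (intro card_mono) auto
    then show ?thesis using B by blast
  qed
  then show ?thesis
    by (auto simp: finite_to_one_mono_iff intro!: monoI card_mono)
qed

lemma q_point_slow_count:
  assumes q: "q_point F" and f: "f \<in> finite_to_one_mono"
  obtains A where "\<forall>\<^sub>F n in F. n \<in> A" "\<And>n. n \<in> A \<Longrightarrow> card (A \<inter> {..<n}) \<le> f n"
proof -
  obtain A where A: "\<forall>\<^sub>F n in F. n \<in> A" "\<And>a b. a \<in> A \<Longrightarrow> b \<in> A \<Longrightarrow> a < b \<Longrightarrow> a < f b"
    by (rule q_point_sparse_set[OF q f]) blast
  have "card (A \<inter> {..<n}) \<le> f n" if "n \<in> A" for n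
  proof -
    have "A \<inter> {..<n} \<subseteq> {..<f n}" using A(2) that by auto
    from card_mono[OF _ this] show ?thesis by simp
  qed
  with A(1) show ?thesis by (rule that)
qed

lemma card_Int_lessThan_le: "card (A \<inter> {..<n :: nat}) \<le> n"
  using card_mono[of "{..<n}" "A \<inter> {..<n}"] by simp

text \<open>
  Given countably many codes, choose \<open>f\<close> below the counting functions of those coded sets that
  lie in the ultrafilter, and below the identity.  A set in the ultrafilter whose counting function
  is below \<open>f\<close> on it has a code strictly above all the given ones; the identity takes care of
  the codes that vanish modulo the ultrafilter.
\<close>

lemma uncountable_cof_range_set_code:
  assumes p: "p_point F" and q: "q_point F"
  shows "natLeq <o cof_mod (range set_code) F"
proof (rule natLeq_less_cof_modI)
  fix E assume E: "countable E" "E \<subseteq> range set_code"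
  have F: "nonprincipal_ultrafilter F" using p by (simp add: p_point_def)
  then obtain \<B> where \<B>: "countable \<B>" "E = set_code ` \<B>"
    using E by (meson countable_subset_image)
  define count :: "nat set \<Rightarrow> nat \<Rightarrow> nat" where "count A n = card (A \<inter> {..<n})" for A n
  define C where "C = insert (\<lambda>n. n) (count ` {B \<in> \<B>. \<forall>\<^sub>F n in F. n \<in> B})"
  have "(\<lambda>n. n) \<in> finite_to_one_mono" by (auto simp: finite_to_one_mono_iff mono_def)
  then have "C \<subseteq> finite_to_one_mono"
    using count_below_finite_to_one_mono[OF F] by (auto simp: C_def count_def[abs_def])
  moreover have "countable C" using \<B> by (simp add: C_def)
  ultimately obtain f where f: "f \<in> finite_to_one_mono" and less: "\<And>g. g \<in> C \<Longrightarrow> lt_mod F f g"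
    using countable_finite_to_one_mono_lower_bound[OF p] by metis
  obtain A where A: "\<forall>\<^sub>F n in F. n \<in> A" "\<And>n. n \<in> A \<Longrightarrow> card (A \<inter> {..<n}) \<le> f n"
    by (rule q_point_slow_count[OF q f]) blast
  have "lt_mod F (set_code B) (set_code A)" if B: "B \<in> \<B>" for B
  proof (cases "\<forall>\<^sub>F n in F. n \<in> B")
    case True
    then have "\<forall>\<^sub>F n in F. f n < count B n"
      using B less[of "count B"] by (simp add: C_def lt_mod_def)
    with A(1) True have "\<forall>\<^sub>F n in F. n \<in> A \<and> n \<in> B \<and> f n < count B n"
      by (simp add: eventually_conj_iff)
    then show ?thesis
      unfolding lt_mod_def
    proof (rule eventually_mono)
      fix n assume n: "n \<in> A \<and> n \<in> B \<and> f n < count B n"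
      then have "card (A \<inter> {..<n}) < card (B \<inter> {..<n})"
        using A(2)[of n] by (simp add: count_def)
      then have "n - card (B \<inter> {..<n}) < n - card (A \<inter> {..<n})"
        using card_Int_lessThan_le[of B n] by linarith
      with n show "set_code B n < set_code A n" by (simp add: set_code_def)
    qed
  next
    case False
    then have "\<forall>\<^sub>F n in F. n \<notin> B" using ultrafilter_dichotomy[OF F] by blast
    moreover have "\<forall>\<^sub>F n in F. f n < n"
      using less[of "\<lambda>n. n"] by (simp add: C_def lt_mod_def)
    ultimately have "\<forall>\<^sub>F n in F. n \<in> A \<and> n \<notin> B \<and> f n < n"
      using A(1) by (simp add: eventually_conj_iff)
    then show ?thesis
      unfolding lt_mod_def
    proof (rule eventually_mono)
      fix n assume n: "n \<in> A \<and> n \<notin> B \<and> f n < n"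
      then have "card (A \<inter> {..<n}) < n" using A(2)[of n] by linarith
      with n show "set_code B n < set_code A n" by (simp add: set_code_def)
    qed
  qed
  then have "\<forall>y\<in>E. \<not> le_mod F (set_code A) y" using \<B> not_le_mod_iff[OF F] by blast
  then show "\<exists>x\<in>range set_code. \<forall>y\<in>E. \<not> le_mod F x y" by blast
qed

text \<open>
  Choosing, for each member of a coinitial family, a set in the ultrafilter whose
  counting function is nowhere larger on it turns the family into a cofinal set of codes.
\<close>

lemma cof_range_set_code_le_cin:
  assumes q: "q_point F"
  shows "cof_mod (range set_code) F \<le>o cin_mod F"
proof -
  have F: "nonprincipal_ultrafilter F" using q by (simp add: q_point_def)
  obtain D where D: "D \<subseteq> finite_to_one_mono"
    "\<And>f. f \<in> finite_to_one_mono \<Longrightarrow> \<exists>g\<in>D. le_mod F g f" "cin_mod F = |D|"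
    by (rule cin_modE) blast
  have "\<exists>A. (\<forall>\<^sub>F n in F. n \<in> A) \<and> (\<forall>n\<in>A. card (A \<inter> {..<n}) \<le> g n)" if "g \<in> D" for g
    using q_point_slow_count[OF q, of g] D(1) that by (metis subsetD)
  then obtain A where A: "\<And>g. g \<in> D \<Longrightarrow> \<forall>\<^sub>F n in F. n \<in> A g"
    "\<And>g n. g \<in> D \<Longrightarrow> n \<in> A g \<Longrightarrow> card (A g \<inter> {..<n}) \<le> g n"
    by metis
  have "cof_mod (range set_code) F \<le>o |(\<lambda>g. set_code (A g)) ` D|"
  proof (rule cof_mod_le)
    fix x assume "x \<in> range set_code"
    then obtain B where x: "x = set_code B" by blast
    have "\<exists>g\<in>D. le_mod F x (set_code (A g))"
    proof (cases "\<forall>\<^sub>F n in F. n \<in> B")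
      case True
      from D(2)[OF count_below_finite_to_one_mono[OF F True]] obtain g
        where g: "g \<in> D" "\<forall>\<^sub>F n in F. g n \<le> card (B \<inter> {..<n})" by (auto simp: le_mod_def)
      with A(1) True have "\<forall>\<^sub>F n in F. n \<in> A g \<and> n \<in> B \<and> g n \<le> card (B \<inter> {..<n})"
        by (simp add: eventually_conj_iff)
      then have "le_mod F x (set_code (A g))"
        unfolding le_mod_def x
      proof (rule eventually_mono)
        fix n assume n: "n \<in> A g \<and> n \<in> B \<and> g n \<le> card (B \<inter> {..<n})"
        then have "card (A g \<inter> {..<n}) \<le> card (B \<inter> {..<n})"
          using A(2)[OF g(1), of n] by linarith
        with n show "set_code B n \<le> set_code (A g) n" by (simp add: set_code_def)
      qed
      with g show ?thesis by blast
    next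
      case False
      then have "\<forall>\<^sub>F n in F. n \<notin> B" using ultrafilter_dichotomy[OF F] by blast
      then have "le_mod F x y" for y
        unfolding le_mod_def x by (rule eventually_mono) (simp add: set_code_def)
      moreover have "(\<lambda>n. n) \<in> finite_to_one_mono"
        by (auto simp: finite_to_one_mono_iff mono_def)
      ultimately show ?thesis using D(2) by blast
    qed
    then show "\<exists>y\<in>(\<lambda>g. set_code (A g)) ` D. le_mod F x y" by blast
  qed blast
  also have "|(\<lambda>g. set_code (A g)) ` D| \<le>o |D|" by (rule card_of_image)
  finally show ?thesis by (simp add: D(3))
qed

section \<open>Compact sets of uncountable cofinality\<close>

lemma finite_coordinate_of_compact:
  fixes K :: "(nat \<Rightarrow> nat) set"
  assumes "compact K"
  shows "finite ((\<lambda>x. x n) ` K)"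
proof (cases "K = {}")
  case False
  have "compact ((\<lambda>x. x n) ` K)"
    using continuous_on_subset[OF continuous_on_product_coordinates subset_UNIV] assms
    by (rule compact_continuous_image)
  from compact_attains_sup[OF this] False
  obtain s where "\<forall>t\<in>(\<lambda>x. x n) ` K. t \<le> s" by blast
  then have "(\<lambda>x. x n) ` K \<subseteq> {..s}" by auto
  then show ?thesis by (rule finite_subset) simp
qed simp

definition initial :: "nat \<Rightarrow> (nat \<Rightarrow> nat) \<Rightarrow> nat list" where
  "initial k x = map x [0..<k]"

lemma initial_eq_iff: "initial k x = initial k y \<longleftrightarrow> (\<forall>m<k. x m = y m)"
  by (auto simp: initial_def)

lemma finite_initial_of_compact:
  assumes "compact K"
  shows "finite (initial k ` K)"
proof (induction k)
  case 0
  then show ?case by (simp add: initial_def image_constant_conv)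
next
  case (Suc k)
  have "initial (Suc k) ` K \<subseteq> (\<lambda>(s, a). s @ [a]) ` (initial k ` K \<times> (\<lambda>x. x k) ` K)"
    by (auto simp: initial_def)
  then show ?case
    by (rule finite_subset) (use Suc finite_coordinate_of_compact[OF assms] in blast)
qed

text \<open>
  Call a finite sequence small if \<open>K\<close> has an element strictly above everything in its cylinder.
  There are countably many of them, so some element of \<open>K\<close> exceeds all the chosen bounds and any
  prescribed \<open>w \<in> K\<close>.  Whatever exceeds all the bounds has no small initial segment, which keeps
  every witness inside the core.
\<close>

lemma cylinders_cofinal_core:
  assumes F: "nonprincipal_ultrafilter F" and K: "natLeq <o cof_mod K F"
  obtains K' where "K' \<subseteq> K" "K' \<noteq> {}"
    "\<And>x k w. x \<in> K' \<Longrightarrow> w \<in> K \<Longrightarrow> \<exists>z\<in>K'. initial k z = initial k x \<and> lt_mod F w z"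
proof -
  define bounds where
    "bounds s y \<longleftrightarrow> y \<in> K \<and> (\<forall>z\<in>K. initial (length s) z = s \<longrightarrow> lt_mod F z y)" for s y
  define small where "small s \<longleftrightarrow> (\<exists>y. bounds s y)" for s
  define Y where "Y s = (SOME y. bounds s y)" for s
  have Y: "bounds s (Y s)" if "small s" for s
    using that unfolding small_def Y_def by (rule someI_ex)
  define K' where "K' = {x \<in> K. \<forall>k. \<not> small (initial k x)}"
  define E where "E = Y ` {s. small s}"
  have E: "countable E" "E \<subseteq> K" using Y by (auto simp: E_def bounds_def)
  have len: "length (initial k x) = k" for k x by (simp add: initial_def)
  have above_E: "x \<in> K'" if "x \<in> K" "\<And>y. y \<in> E \<Longrightarrow> lt_mod F y x" for x
  proof -
    have "\<not> small (initial k x)" for k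
    proof
      assume s: "small (initial k x)"
      then have "lt_mod F x (Y (initial k x))"
        using Y[OF s] that(1) by (simp add: bounds_def len)
      moreover have "lt_mod F (Y (initial k x)) x" using s by (intro that(2)) (simp add: E_def)
      ultimately have "lt_mod F x x"
        by (rule lt_mod_trans)
      then show False using not_lt_mod_self[OF F] by blast
    qed
    then show ?thesis using that(1) by (simp add: K'_def)
  qed
  show ?thesis
  proof
    show "K' \<subseteq> K" by (auto simp: K'_def)
    show "K' \<noteq> {}"
      by (rule natLeq_less_cof_modD[OF F K E]) (use above_E in blast)
    fix x k w assume x: "x \<in> K'" and w: "w \<in> K"
    have "countable (insert w E)" "insert w E \<subseteq> K" using E w by auto
    then obtain v where v: "v \<in> K" "\<And>y. y \<in> insert w E \<Longrightarrow> lt_mod F y v"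
      by (rule natLeq_less_cof_modD[OF F K]) blast
    have "\<not> bounds (initial k x) v" using x by (auto simp: K'_def small_def)
    then obtain z where z: "z \<in> K" "initial k z = initial k x" "le_mod F v z"
      using v(1) not_le_mod_iff[OF F] by (auto simp: bounds_def len)
    have above: "lt_mod F y z" if "y \<in> insert w E" for y
      using v(2)[OF that] z(3) by (rule lt_mod_le_trans)
    then have "z \<in> K'" using z(1) by (intro above_E) auto
    with z above show "\<exists>z\<in>K'. initial k z = initial k x \<and> lt_mod F w z" by blast
  qed
qed

text \<open>
  Along the increasing enumeration of \<open>A\<close>, repeatedly replace the current element of
  \<open>K'\<close> by one that agrees with it up to the last point treated and is maximal at the next.  The
  successive elements stabilise at every coordinate.  Their limit is only claimed to lie in
  \<open>K\<close>, since \<open>K'\<close> may fail to be closed; its maximality at the points of \<open>A\<close> is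
  inherited from the approximations, which do belong to \<open>K'\<close>.
\<close>

lemma greedy_branch:
  fixes K :: "(nat \<Rightarrow> nat) set"
  assumes K: "compact K" and K': "K' \<subseteq> K" "K' \<noteq> {}" and A: "infinite A"
  obtains x where "x \<in> K"
    "\<And>b. b \<in> A \<Longrightarrow> (\<exists>a\<in>A. a < b) \<Longrightarrow>
      \<exists>a\<in>A. a < b \<and> (\<exists>v\<in>K'. \<forall>y\<in>K'. initial (Suc a) y = initial (Suc a) v \<longrightarrow> y b \<le> x b)"
proof -
  define e where "e = enumerate A"
  have e_mono: "strict_mono e" using A unfolding e_def by (rule strict_mono_enumerate)
  have e_ge: "i \<le> e i" for i using e_mono by (rule strict_mono_imp_increasing)
  define step where "step i z z' \<longleftrightarrow> initial (Suc (e i)) z' = initial (Suc (e i)) z \<and>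
     (\<forall>y\<in>K'. initial (Suc (e i)) y = initial (Suc (e i)) z \<longrightarrow> y (e (Suc i)) \<le> z' (e (Suc i)))"
    for i z z'
  have "\<exists>z'. z' \<in> K' \<and> step i z z'" if z: "z \<in> K'" for i z
  proof -
    define S where "S = {y \<in> K'. initial (Suc (e i)) y = initial (Suc (e i)) z}"
    define T where "T = (\<lambda>y. y (e (Suc i))) ` S"
    have "T \<subseteq> (\<lambda>y. y (e (Suc i))) ` K" using K' by (auto simp: S_def T_def)
    then have "finite T" using finite_coordinate_of_compact[OF K] by (rule finite_subset)
    moreover have "T \<noteq> {}" using z by (auto simp: S_def T_def)
    ultimately have "Max T \<in> T" and max: "\<And>t. t \<in> T \<Longrightarrow> t \<le> Max T" by simp_all
    then obtain z' where "z' \<in> S" "z' (e (Suc i)) = Max T" by (auto simp: T_def)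
    moreover from this(2) have "\<forall>y\<in>S. y (e (Suc i)) \<le> z' (e (Suc i))"
      using max by (simp add: T_def)
    ultimately have "z' \<in> S" "\<forall>y\<in>S. y (e (Suc i)) \<le> z' (e (Suc i))" by simp_all
    then have "z' \<in> K' \<and> step i z z'" by (auto simp: S_def step_def)
    then show ?thesis by blast
  qed
  with dependent_nat_choice[of "\<lambda>_ z. z \<in> K'" step] K'(2)
  obtain z where z: "\<And>i. z i \<in> K'" "\<And>i. step i (z i) (z (Suc i))" by blast
  have agree: "z (i + d) m = z i m" if "m \<le> e i" for i d m
  proof (induction d)
    case (Suc d)
    have "m \<le> e (i + d)" using that e_mono by (metis le_add1 order_trans strict_mono_less_eq)
    then have "z (Suc (i + d)) m = z (i + d) m"
      using z(2)[of "i + d"] by (simp add: step_def initial_eq_iff)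
    with Suc show ?case by simp
  qed simp
  \<comment> \<open>Coordinate \<open>m\<close> is final from stage \<open>m\<close> on, because \<open>m \<le> e m\<close>.\<close>
  define x where "x m = z m m" for m
  have x_eq: "x m = z i m" if "m \<le> e i" for i m
  proof (cases "i \<le> m")
    case True
    then show ?thesis using agree[OF that, of "m - i"] by (simp add: x_def)
  next
    case False
    then show ?thesis using agree[OF e_ge, of m "i - m"] by (simp add: x_def)
  qed
  have "z \<longlonglongrightarrow> x"
  proof -
    have "(\<lambda>i. z i m) \<longlonglongrightarrow> x m" for m
    proof (rule tendsto_eventually)
      show "\<forall>\<^sub>F i in sequentially. z i m = x m"
        using eventually_ge_at_top[of m]
        by (rule eventually_mono) (metis e_ge order_trans x_eq)
    qed
    then have "limitin (product_topology (\<lambda>_. euclidean) UNIV) z x sequentially"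
      by (simp add: limitin_componentwise)
    then show ?thesis by (simp add: euclidean_product_topology)
  qed
  moreover have "closed K"
  proof -
    have "Hausdorff_space (euclidean :: nat topology)"
      unfolding Hausdorff_space_def
    proof (intro allI impI)
      fix m n :: nat assume "m \<in> topspace euclidean \<and> n \<in> topspace euclidean \<and> m \<noteq> n"
      then show "\<exists>U V. openin euclidean U \<and> openin euclidean V \<and> m \<in> U \<and> n \<in> V \<and> disjnt U V"
        by (intro exI[of _ "{m}"] exI[of _ "{n}"]) (simp add: open_discrete)
    qed
    then have "Hausdorff_space (product_topology (\<lambda>_::nat. euclidean :: nat topology) UNIV)"
      by (simp add: Hausdorff_space_product_topology)
    then have "Hausdorff_space (euclidean :: (nat \<Rightarrow> nat) topology)"
      by (simp only: euclidean_product_topology)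
    from compactin_imp_closedin[OF this] K show ?thesis by simp
  qed
  ultimately have "x \<in> K"
    using z(1) K'(1) by (meson closed_sequentially subsetD)
  then show ?thesis
  proof (rule that)
    fix b assume "b \<in> A" "\<exists>a\<in>A. a < b"
    obtain j where j: "b = e j" using \<open>b \<in> A\<close> A enumerate_Ex unfolding e_def by metis
    have "j \<noteq> 0"
    proof
      assume "j = 0"
      obtain a i where "a = e i" "a < b"
        using \<open>\<exists>a\<in>A. a < b\<close> A enumerate_Ex unfolding e_def by metis
      with j \<open>j = 0\<close> e_mono show False by (simp add: strict_mono_less)
    qed
    then obtain i where i: "j = Suc i" by (cases j) auto
    have "x b = z (Suc i) b" using x_eq j i by simp
    then have "\<forall>y\<in>K'. initial (Suc (e i)) y = initial (Suc (e i)) (z i) \<longrightarrow> y b \<le> x b"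
      using z(2)[of i] by (simp add: step_def j i)
    moreover have "e i < b" using e_mono by (simp add: j i strict_mono_less)
    moreover have "e i \<in> A" unfolding e_def using A by (rule enumerate_in_set)
    ultimately show "\<exists>a\<in>A. a < b \<and>
        (\<exists>v\<in>K'. \<forall>y\<in>K'. initial (Suc a) y = initial (Suc a) v \<longrightarrow> y b \<le> x b)"
      using z(1) by blast
  qed
qed

text \<open>
  A cofinal \<open>D \<subseteq> K\<close> yields a coinitial family indexed by \<open>D\<close>: \<open>\<phi> w\<close> measures how
  long an initial segment can be prescribed at stage \<open>n\<close> while it is still possible to beat
  \<open>w\<close> at \<open>n\<close>.  A function strictly below every \<open>\<phi> w\<close> gives a set along which one greedy
  branch beats every \<open>w \<in> D\<close>.
\<close>

lemma cin_le_cof_compact: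
  assumes p: "p_point F" and q: "q_point F" and K: "compact K" and unc: "natLeq <o cof_mod K F"
  shows "cin_mod F \<le>o cof_mod K F"
proof -
  have F: "nonprincipal_ultrafilter F" using p by (simp add: p_point_def)
  obtain K' where K': "K' \<subseteq> K" "K' \<noteq> {}"
    and core: "\<And>x k w. x \<in> K' \<Longrightarrow> w \<in> K \<Longrightarrow> \<exists>z\<in>K'. initial k z = initial k x \<and> lt_mod F w z"
    by (rule cylinders_cofinal_core[OF F unc]) blast
  define beaten where
    "beaten w k n \<longleftrightarrow> (\<forall>x\<in>K'. \<exists>z\<in>K'. initial k z = initial k x \<and> w n < z n)" for w k n
  obtain D where D: "D \<subseteq> K" "\<And>f. f \<in> K \<Longrightarrow> \<exists>g\<in>D. le_mod F f g" "cof_mod K F = |D|"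
    by (rule cof_modE) blast
  have "\<exists>f. f \<in> finite_to_one_mono \<and> (\<forall>\<^sub>F n in F. \<forall>k\<le>f n. beaten w k n)" if w: "w \<in> D" for w
  proof -
    have "\<forall>\<^sub>F n in F. beaten w k n" for k
    proof -
      have "\<forall>s\<in>initial k ` K'. \<forall>\<^sub>F n in F. \<exists>z\<in>K'. initial k z = s \<and> w n < z n"
      proof
        fix s assume "s \<in> initial k ` K'"
        then obtain z where z: "z \<in> K'" "initial k z = s" "\<forall>\<^sub>F n in F. w n < z n"
          using core w D(1) unfolding lt_mod_def by blast
        from z(3) show "\<forall>\<^sub>F n in F. \<exists>z\<in>K'. initial k z = s \<and> w n < z n"
          by (rule eventually_mono) (use z(1,2) in blast)
      qed
      moreover have "finite (initial k ` K')"
        by (rule finite_subset[OF _ finite_initial_of_compact[OF K]]) (use K' in blast)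
      ultimately have "\<forall>\<^sub>F n in F. \<forall>s\<in>initial k ` K'. \<exists>z\<in>K'. initial k z = s \<and> w n < z n"
        by (simp only: eventually_ball_finite_distrib)
      then show ?thesis by (rule eventually_mono) (auto simp: beaten_def)
    qed
    from p_point_diagonal[OF p, of "beaten w", OF this] show ?thesis by metis
  qed
  then obtain \<phi> where \<phi>: "\<And>w. w \<in> D \<Longrightarrow> \<phi> w \<in> finite_to_one_mono"
    "\<And>w. w \<in> D \<Longrightarrow> \<forall>\<^sub>F n in F. \<forall>k\<le>\<phi> w n. beaten w k n"
    by metis
  have "cin_mod F \<le>o |\<phi> ` D|"
  proof (rule cin_mod_le)
    show "\<phi> ` D \<subseteq> finite_to_one_mono" using \<phi>(1) by blast
    fix f assume f: "f \<in> finite_to_one_mono"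
    show "\<exists>g\<in>\<phi> ` D. le_mod F g f"
    proof (rule ccontr)
      assume "\<not> ?thesis"
      then have below: "lt_mod F f (\<phi> w)" if "w \<in> D" for w
        using that not_le_mod_iff[OF F] by blast
      obtain A where A: "\<forall>\<^sub>F n in F. n \<in> A"
        "\<And>a b. a \<in> A \<Longrightarrow> b \<in> A \<Longrightarrow> a < b \<Longrightarrow> a < f b"
        by (rule q_point_sparse_set[OF q f]) blast
      have infA: "infinite A" using F A(1) by (rule infinite_if_eventually_mem)
      obtain x where x: "x \<in> K" and greedy: "\<And>b. b \<in> A \<Longrightarrow> (\<exists>a\<in>A. a < b) \<Longrightarrow>
          \<exists>a\<in>A. a < b \<and> (\<exists>v\<in>K'. \<forall>y\<in>K'. initial (Suc a) y = initial (Suc a) v \<longrightarrow> y b \<le> x b)"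
        by (rule greedy_branch[OF K K' infA]) blast
      obtain a\<^sub>0 where a0: "a\<^sub>0 \<in> A" using infA by (metis finite.emptyI ex_in_conv)
      \<comment> \<open>By cofinality some \<open>w \<in> D\<close> bounds the greedy branch, but the branch exceeds it.\<close>
      obtain w where w: "w \<in> D" "le_mod F x w" using D(2)[OF x] by blast
      have "\<forall>\<^sub>F n in F. n \<in> A \<and> Suc a\<^sub>0 \<le> n \<and> f n < \<phi> w n \<and> (\<forall>k\<le>\<phi> w n. beaten w k n)"
        using A(1) eventually_ge_nonprincipal[OF F, of "Suc a\<^sub>0"] below[OF w(1)] \<phi>(2)[OF w(1)]
        by (simp add: eventually_conj_iff lt_mod_def)
      then have "lt_mod F w x"
        unfolding lt_mod_def
      proof (rule eventually_mono)
        fix n assume n: "n \<in> A \<and> Suc a\<^sub>0 \<le> n \<and> f n < \<phi> w n \<and> (\<forall>k\<le>\<phi> w n. beaten w k n)"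
        then have "n \<in> A" "\<exists>a\<in>A. a < n" using a0 by (auto simp: Suc_le_eq)
        from greedy[OF this] obtain a v where a: "a \<in> A" "a < n" "v \<in> K'"
          and max: "\<And>y. y \<in> K' \<Longrightarrow> initial (Suc a) y = initial (Suc a) v \<Longrightarrow> y n \<le> x n"
          by blast
        have "Suc a \<le> \<phi> w n" using A(2)[OF a(1) _ a(2)] n by auto
        then have "beaten w (Suc a) n" using n by blast
        then obtain z where "z \<in> K'" "initial (Suc a) z = initial (Suc a) v" "w n < z n"
          using a(3) by (auto simp: beaten_def)
        then show "w n < x n" using max by fastforce
      qed
      with w(2) show False using not_le_mod_iff[OF F] by blast
    qed
  qed
  also have "|\<phi> ` D| \<le>o |D|" by (rule card_of_image)
  finally show ?thesis by (simp add: D(3))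
qed

theorem theorem2p7:
  fixes \<U> :: "nat filter"
  assumes "selective \<U>"
  shows "michael_ultrafilter \<U> \<longleftrightarrow> cof_mod UNIV \<U> \<le>o cin_mod \<U>"
proof
  have p: "p_point \<U>" and q: "q_point \<U>" using assms by (simp_all add: selective_def)
  then have U: "nonprincipal_ultrafilter \<U>" by (simp add: p_point_def)
  show "cof_mod UNIV \<U> \<le>o cin_mod \<U>" if "michael_ultrafilter \<U>"
  proof -
    have "cof_mod UNIV \<U> \<le>o cof_mod (range set_code) \<U>"
      using that compact_range_set_code uncountable_cof_range_set_code[OF p q]
      by (simp add: michael_ultrafilter_def)
    also have "cof_mod (range set_code) \<U> \<le>o cin_mod \<U>"
      by (rule cof_range_set_code_le_cin[OF q])
    finally show ?thesis .
  qed
  show "michael_ultrafilter \<U>" if "cof_mod UNIV \<U> \<le>o cin_mod \<U>"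
    unfolding michael_ultrafilter_def
    using U ordLeq_transitive[OF that cin_le_cof_compact[OF p q]] by blast
qed

end
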